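(* For every natural number $l \ge 4$, $h(4,l) \le \binom{l-1}{2}+1$, where $h$ is the convexification function defined in the context.
   Context: All point sets are finite, in the plane, non-vertical (no vertical line contains two of the points) and in general position (no three points collinear), including unions of two sets under consideration. Points $(x_1,y_1),\dots,(x_k,y_k)$ form a $k$-cup if $x_1<\dots<x_k$ and the slopes $\frac{y_{i+1}-y_i}{x_{i+1}-x_i}$ are strictly increasing; they form a $k$-cap if $x_1<\dots<x_k$ and these slopes are strictly decreasing. For $m,l\ge 3$ a set is $(m,l)$-free if it contains no $m$-cup and no $l$-cap. A convex $n$-gon means $n$ points of the set in convex position. For $m,l \ge 3$, a point $s$ of a set $S$ is an $(m,l)$-convexifying point for $S$ if $s$ is the leftmost point of an $(l-1)$-cap in $S$ and, for every natural number $n\ge 4$ and every set $B$ with $B\cap S=\emptyset$ such that $B\cup S$ contains an $(n-1)$-cup whose left endpoint is $s$ and whose right endpoint is in $B$, the set $B\cup S$ contains at least one of: an $m$-cup whose two leftmost points belong to $S$; an $l$-cap whose two rightmost points belong to $S$; a convex $n$-gon. The convexification function $h(m,l)$ is the maximum number such that there exists an $(m,l)$-free set of $h(m,l)$ points with no $(m,l)$-convexifying point. *)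

theory Defs
  imports "HOL-Analysis.Analysis"
begin

type_synonym point = "real \<times> real"

definition admissible :: "point set \<Rightarrow> bool" where
  "admissible P \<longleftrightarrow> finite P \<and> inj_on fst P \<and>
     (\<forall>a\<in>P. \<forall>b\<in>P. \<forall>c\<in>P. a \<noteq> b \<and> a \<noteq> c \<and> b \<noteq> c \<longrightarrow> \<not> collinear {a, b, c})"

definition slope :: "point \<Rightarrow> point \<Rightarrow> real" where
  "slope p q = (snd q - snd p) / (fst q - fst p)"

text \<open>Cups and caps are lists of points in left-to-right order, so that their left and right
  endpoints are \<open>hd ps\<close> and \<open>last ps\<close>; \<open>map2 slope ps (tl ps)\<close> is the list of the slopes of
  consecutive points.\<close>

definition is_cup :: "nat \<Rightarrow> point list \<Rightarrow> bool" where
  "is_cup k ps \<longleftrightarrow> length ps = k \<and> sorted_wrt (<) (map fst ps) \<and>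
     sorted_wrt (<) (map2 slope ps (tl ps))"

definition is_cap :: "nat \<Rightarrow> point list \<Rightarrow> bool" where
  "is_cap k ps \<longleftrightarrow> length ps = k \<and> sorted_wrt (<) (map fst ps) \<and>
     sorted_wrt (>) (map2 slope ps (tl ps))"

definition cup_cap_free :: "nat \<Rightarrow> nat \<Rightarrow> point set \<Rightarrow> bool" where
  "cup_cap_free m l S \<longleftrightarrow>
     (\<nexists>ps. set ps \<subseteq> S \<and> is_cup m ps) \<and> (\<nexists>ps. set ps \<subseteq> S \<and> is_cap l ps)"

definition convex_position :: "point set \<Rightarrow> bool" where
  "convex_position T \<longleftrightarrow> (\<forall>p\<in>T. p \<notin> convex hull (T - {p}))"

definition has_convex_gon :: "nat \<Rightarrow> point set \<Rightarrow> bool" where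
  "has_convex_gon n P \<longleftrightarrow> (\<exists>T\<subseteq>P. finite T \<and> card T = n \<and> convex_position T)"

text \<open>Admissibility is required of \<open>B \<union> S\<close>, and hence holds for \<open>B\<close> and \<open>S\<close>
  separately.\<close>

definition convexifying_point :: "nat \<Rightarrow> nat \<Rightarrow> point set \<Rightarrow> point \<Rightarrow> bool" where
  "convexifying_point m l S s \<longleftrightarrow> s \<in> S \<and>
     (\<exists>ps. set ps \<subseteq> S \<and> is_cap (l - 1) ps \<and> hd ps = s) \<and>
     (\<forall>n\<ge>4. \<forall>B. B \<inter> S = {} \<and> admissible (B \<union> S) \<and>
        (\<exists>ps. set ps \<subseteq> B \<union> S \<and> is_cup (n - 1) ps \<and> hd ps = s \<and> last ps \<in> B) \<longrightarrow>
        (\<exists>ps. set ps \<subseteq> B \<union> S \<and> is_cup m ps \<and> set (take 2 ps) \<subseteq> S) \<or>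
        (\<exists>ps. set ps \<subseteq> B \<union> S \<and> is_cap l ps \<and> set (drop (l - 2) ps) \<subseteq> S) \<or>
        has_convex_gon n (B \<union> S))"

definition convexification :: "nat \<Rightarrow> nat \<Rightarrow> nat" where
  "convexification m l = (GREATEST k. \<exists>S. admissible S \<and> card S = k \<and>
     cup_cap_free m l S \<and> (\<nexists>s. convexifying_point m l S s))"

end

theory Submission imports Defs begin

text \<open>Let \<open>S\<close> be free with \<open>card S > (l-1 choose 2) + 1\<close>. By the Erdos--Szekeres cup-cap theorem,
  \<open>S\<close> minus its leftmost point \<open>a\<close> still contains an \<open>(l-1)\<close>-cap \<open>s, c, d, \<dots>\<close>; then \<open>s\<close> is
  convexifying. Freeness forces \<open>slope a s < slope s c\<close>. Let \<open>s, \<dots>, q, r, b\<close> be an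
  \<open>(n-1)\<close>-cup with \<open>b \<in> B\<close>.
  If \<open>c\<close> lies above the line \<open>s b\<close>, then either \<open>c\<close> completes the cup to a convex
  \<open>n\<close>-gon, or \<open>r, b, c, d, \<dots>\<close> is an \<open>l\<close>-cap.
  If \<open>c\<close> lies below that line and to the left of \<open>b\<close>, then \<open>a, s, c, b\<close> is a \<open>4\<close>-cup.
  Otherwise \<open>a, s, r, b\<close> is a \<open>4\<close>-cup unless \<open>r\<close> is below the line \<open>a s\<close>; in that case either
  \<open>q, r, c, d, \<dots>\<close> is an \<open>l\<close>-cap, or \<open>s, \<dots>, q, r, c\<close> is a cup which \<open>b\<close> completes to a
  convex \<open>n\<close>-gon.\<close>

section \<open>Slopes\<close>

lemma slope_commute: "slope p q = slope q p"
  unfolding slope_def by (metis minus_diff_eq minus_divide_divide)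

lemma slope_times_diff: "fst p \<noteq> fst q \<Longrightarrow> slope p q * (fst q - fst p) = snd q - snd p"
  unfolding slope_def by simp

lemma slope_mean:
  assumes "fst p < fst q" "fst q < fst r"
  shows "slope p r * (fst r - fst p) =
    slope p q * (fst q - fst p) + slope q r * (fst r - fst q)"
  using assms by (simp add: slope_times_diff)

text \<open>By \<open>slope_mean\<close>, \<open>slope p r\<close> is a weighted mean of
  \<open>slope p q\<close> and \<open>slope q r\<close>, with positive weights. Hence it lies on the
  same side of \<open>slope p q\<close> as \<open>slope q r\<close> does.\<close>

lemma slope_less_iff_left:
  assumes "fst p < fst q" "fst q < fst r"
  shows "slope p q < slope p r \<longleftrightarrow> slope p q < slope q r"
proof -
  have "(slope p r - slope p q) * (fst r - fst p) = (slope q r - slope p q) * (fst r - fst q)"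
    using slope_mean[OF assms] by (simp add: algebra_simps)
  then show ?thesis
    using assms by (smt (verit) mult_pos_pos zero_less_mult_pos2)
qed

lemma slope_less_iff_right:
  assumes "fst p < fst q" "fst q < fst r"
  shows "slope p r < slope q r \<longleftrightarrow> slope p q < slope q r"
proof -
  have "(slope q r - slope p r) * (fst r - fst p) = (slope q r - slope p q) * (fst q - fst p)"
    using slope_mean[OF assms] by (simp add: algebra_simps)
  then show ?thesis
    using assms by (smt (verit) mult_pos_pos zero_less_mult_pos2)
qed

lemma collinear_if_slope_eq:
  assumes "fst p \<noteq> fst q" "fst r \<noteq> fst q" "slope p q = slope q r"
  shows "collinear {p, q, r}"
proof -
  have "snd p - snd q = slope q r * (fst p - fst q)" "snd r - snd q = slope q r * (fst r - fst q)"
    using assms slope_times_diff[of q p] slope_times_diff[of q r] slope_commute[of p q] by simp_all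
  then have "r - q = ((fst r - fst q) / (fst p - fst q)) *\<^sub>R (p - q)"
    using assms(1) by (simp add: prod_eq_iff)
  then show ?thesis
    by (subst collinear_3) (auto simp: collinear_lemma)
qed

text \<open>This turns general position into strict alternatives: at a middle point, consecutive
  slopes either increase or decrease, so a cup or a cap can be extended.\<close>

lemma admissible_slope_neq:
  assumes "admissible P" "p \<in> P" "q \<in> P" "r \<in> P" "p \<noteq> q" "p \<noteq> r" "q \<noteq> r"
  shows "slope p q \<noteq> slope q r"
proof
  assume "slope p q = slope q r"
  moreover have "fst p \<noteq> fst q" "fst r \<noteq> fst q"
    using assms unfolding admissible_def inj_on_def by metis+
  ultimately have "collinear {p, q, r}" by (intro collinear_if_slope_eq)
  then show False using assms unfolding admissible_def by blast
qed

lemma admissible_subset: "admissible P \<Longrightarrow> Q \<subseteq> P \<Longrightarrow> admissible Q"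
  unfolding admissible_def by (meson finite_subset inj_on_subset subsetD)

section \<open>Cups and caps\<close>

text \<open>Splitting the slope list at the shared point \<open>q\<close> lets a cup change at its
  right end while the earlier slopes stay the same.\<close>

lemma map2_tl_append:
  "map2 f (xs @ q # ys) (tl (xs @ q # ys)) =
    map2 f (xs @ [q]) (tl (xs @ [q])) @ map2 f (q # ys) ys"
proof (induction xs)
  case (Cons x xs)
  then show ?case by (cases xs) auto
qed simp

lemma is_cup_snoc:
  assumes "is_cup k (xs @ [q, r])" "fst r < fst z" "slope q r < slope r z"
  shows "is_cup (Suc k) (xs @ [q, r, z])"
  using assms map2_tl_append[of slope xs q "[r]"] map2_tl_append[of slope xs q "[r, z]"]
  unfolding is_cup_def by (auto simp: sorted_wrt_append intro: less_trans)

lemma is_cup_butlast: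
  assumes "is_cup (Suc k) (xs @ [q, r])"
  shows "is_cup k (xs @ [q])"
  using assms map2_tl_append[of slope xs q "[r]"]
  unfolding is_cup_def by (auto simp: sorted_wrt_append)

lemma is_cup_last_slope:
  assumes "is_cup k (xs @ [q, r, z])"
  shows "fst q < fst r" "fst r < fst z" "slope q r < slope r z"
  using assms map2_tl_append[of slope xs q "[r, z]"]
  unfolding is_cup_def by (auto simp: sorted_wrt_append)

lemma is_cap_Cons:
  assumes "is_cap k (q # r # xs)" "fst p < fst q" "slope q r < slope p q"
  shows "is_cap (Suc k) (p # q # r # xs)"
  using assms unfolding is_cap_def by auto

lemma is_cap_tl: "is_cap (Suc k) (p # q # xs) \<Longrightarrow> is_cap k (q # xs)"
  unfolding is_cap_def by (cases xs) auto

text \<open>The line of slope \<open>t\<close> through \<open>p\<close> supports the cup. With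
  \<open>t\<close> between the slopes of the two edges at \<open>p\<close>, the height
  \<open>snd z - t * fst z\<close> falls along the cup until \<open>p\<close> and rises
  afterwards.\<close>

lemma cup_supporting_slope:
  assumes cup: "is_cup k ps" and p: "p \<in> set ps"
  obtains t where
    "\<And>q. q \<in> set ps \<Longrightarrow> q \<noteq> p \<Longrightarrow> snd p - t * fst p < snd q - t * fst q"
proof -
  define \<sigma> where "\<sigma> j = slope (ps ! j) (ps ! Suc j)" for j
  define N where "N = length ps"
  obtain i where i: "i < N" "ps ! i = p"
    using p by (auto simp: in_set_conv_nth N_def)
  have fst_mono: "fst (ps ! j) < fst (ps ! j')" if "j < j'" "j' < N" for j j'
    using cup that unfolding is_cup_def N_def by (auto simp: sorted_wrt_iff_nth_less)
  have \<sigma>_mono: "\<sigma> j < \<sigma> j'" if "j < j'" "Suc j' < N" for j j'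
    using cup that unfolding is_cup_def N_def \<sigma>_def
    by (auto simp: sorted_wrt_iff_nth_less nth_tl)
  \<comment> \<open>An endpoint has only one edge, so any slope beyond that of the edge works. For a
    one-point cup \<open>\<sigma> 0\<close> is meaningless but harmless, since there are no other
    points to compare with.\<close>
  define t where "t = (if i = 0 then \<sigma> 0 - 1 else if Suc i = N then \<sigma> (i - 1) + 1
    else (\<sigma> (i - 1) + \<sigma> i) / 2)"
  have below: "\<sigma> j < t" if "j < i" for j
  proof -
    have "\<sigma> j \<le> \<sigma> (i - 1)"
      proof (cases "j = i - 1")
      case False
      then have "j < i - 1" using that by simp
      then show ?thesis using \<sigma>_mono[of j "i - 1"] i by simp
    qed simp
    moreover have "\<sigma> (i - 1) < t"
      using that i \<sigma>_mono[of "i - 1" i] by (auto simp: t_def)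
    ultimately show ?thesis by simp
  qed
  have above: "t < \<sigma> j" if "i \<le> j" "Suc j < N" for j
  proof -
    have "\<sigma> i \<le> \<sigma> j"
      using \<sigma>_mono[of i j] that by (cases "j = i") auto
    moreover have "t < \<sigma> i"
      using that i \<sigma>_mono[of "i - 1" i] by (auto simp: t_def)
    ultimately show ?thesis by simp
  qed
  define g where "g j = snd (ps ! j) - t * fst (ps ! j)" for j
  have step: "g (Suc j) - g j = (\<sigma> j - t) * (fst (ps ! Suc j) - fst (ps ! j))"
    if "Suc j < N" for j
    using slope_times_diff[of "ps ! j" "ps ! Suc j"] fst_mono[of j "Suc j"] that
    unfolding g_def \<sigma>_def by (simp add: algebra_simps)
  have up: "g j < g (Suc j)" if "i \<le> j" "Suc j < N" for j
    using step[of j] above[of j] fst_mono[of j "Suc j"] that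
    by (smt (verit) mult_pos_pos lessI)
  have down: "g (Suc j) < g j" if "j < i" for j
    using step[of j] below[of j] fst_mono[of j "Suc j"] that i
    by (smt (verit) mult_neg_pos lessI Suc_lessI less_trans)
  have right: "g i < g j" if "i < j" "j < N" for j
    using that
  proof (induction j)
    case (Suc j)
    then show ?case using up[of j] by (cases "i = j") auto
  qed simp
  have left: "g i < g j" if "j < i" for j
    using that
  \<comment> \<open>The inequality spreads leftwards from \<open>i\<close>, hence induction on the
    distance to \<open>i\<close>.\<close>
  proof (induction "i - j" arbitrary: j)
    case (Suc d)
    show ?case
    proof (cases "Suc j = i")
      case True
      then show ?thesis using down[of j] by auto
    next
      case False
      then have "g i < g (Suc j)" using Suc.hyps(2) Suc.prems by (intro Suc.hyps(1)) auto
      then show ?thesis using down[OF Suc.prems] by simp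
    qed
  qed simp
  have "snd p - t * fst p < snd q - t * fst q" if q: "q \<in> set ps" "q \<noteq> p" for q
  proof -
    obtain j where j: "j < N" "ps ! j = q"
      using q by (auto simp: in_set_conv_nth N_def)
    with q i have "j \<noteq> i" by auto
    with left[of j] right[of j] j have "g i < g j" by (cases "j < i") auto
    then show ?thesis using i j by (simp add: g_def)
  qed
  then show ?thesis using that by blast
qed

section \<open>Convex position\<close>

lemma convex_half_plane_gt: "convex {z :: point. c < snd z - t * fst z}"
proof -
  have "{z :: point. c < snd z - t * fst z} = {z. inner (- t, 1) z > c}"
    by (auto simp: inner_prod_def)
  then show ?thesis by (simp add: convex_halfspace_gt)
qed

lemma convex_half_plane_le: "convex {z :: point. snd z - t * fst z \<le> c}"
proof -
  have "{z :: point. snd z - t * fst z \<le> c} = {z. inner (- t, 1) z \<le> c}"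
    by (auto simp: inner_prod_def)
  then show ?thesis by (simp add: convex_halfspace_le)
qed

text \<open>An open half-plane with \<open>p\<close> on its boundary contains \<open>T\<close>,
  hence also its convex hull.\<close>

lemma not_in_hull_if_strictly_below:
  assumes "\<And>q. q \<in> T \<Longrightarrow> snd p - t * fst p < snd q - t * fst (q :: point)"
  shows "p \<notin> convex hull T"
proof -
  have "convex hull T \<subseteq> {z. snd p - t * fst p < snd z - t * fst z}"
    using assms by (intro hull_minimal convex_half_plane_gt) auto
  then show ?thesis by auto
qed

lemma cup_convex_position:
  assumes "is_cup k ps"
  shows "convex_position (set ps)"
  unfolding convex_position_def
proof
  fix p assume "p \<in> set ps"
  with assms obtain t where
    "\<And>q. q \<in> set ps \<Longrightarrow> q \<noteq> p \<Longrightarrow> snd p - t * fst p < snd q - t * fst q"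
    using cup_supporting_slope by blast
  then show "p \<notin> convex hull (set ps - {p})"
    by (intro not_in_hull_if_strictly_below[of _ p t]) auto
qed

lemma cup_distinct: "is_cup k ps \<Longrightarrow> distinct ps \<and> card (set ps) = k"
  unfolding is_cup_def
  by (metis distinct_card distinct_map strict_sorted_iff)

lemma cup_has_convex_gon: "is_cup k ps \<Longrightarrow> set ps \<subseteq> P \<Longrightarrow> has_convex_gon k P"
  unfolding has_convex_gon_def using cup_convex_position cup_distinct by blast

lemma cup_fst_bounds:
  assumes "is_cup k ps" "q \<in> set ps"
  shows "fst (hd ps) \<le> fst q" "fst q \<le> fst (last ps)"
proof -
  have sorted: "sorted_wrt (<) (map fst ps)" using assms by (simp add: is_cup_def)
  show "fst (hd ps) \<le> fst q"
    using sorted assms(2) by (cases ps) auto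
  show "fst q \<le> fst (last ps)"
    using sorted assms(2) by (cases ps rule: rev_cases) (auto simp: sorted_wrt_append)
qed

lemma cup_below_chord:
  assumes cup: "is_cup k ps" and q: "q \<in> set ps"
  defines "s \<equiv> hd ps" and "b \<equiv> last ps"
  assumes sb: "fst s < fst b"
  shows "snd q - slope s b * fst q \<le> snd s - slope s b * fst s"
proof (rule ccontr)
  let ?f = "\<lambda>z. snd z - slope s b * fst z"
  assume "\<not> ?thesis"
  then have gt: "?f s < ?f q" by simp
  have "ps \<noteq> []" using q by auto
  then have mem: "s \<in> set ps" "b \<in> set ps" by (auto simp: s_def b_def)
  have fb: "?f b = ?f s" using slope_times_diff[of s b] sb by (simp add: algebra_simps)
  obtain t where t: "\<And>z. z \<in> set ps \<Longrightarrow> z \<noteq> q \<Longrightarrow> snd q - t * fst q < snd z - t * fst z"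
    using cup_supporting_slope[OF cup q] by blast
  have ts: "snd q - t * fst q < snd s - t * fst s" "snd q - t * fst q < snd b - t * fst b"
    using t[OF mem(1)] t[OF mem(2)] gt fb by (metis order_less_irrefl)+
  have bounds: "fst s \<le> fst q" "fst q \<le> fst b"
    using cup_fst_bounds[OF cup q] by (auto simp: s_def b_def)
  \<comment> \<open>If \<open>q\<close> were above the chord, each edge of the triangle
    \<open>s q b\<close> would constrain a supporting slope \<open>t\<close> at \<open>q\<close>:
    the left one gives \<open>t > slope s b\<close>, the right one
    \<open>t < slope s b\<close>.\<close>
  have "(slope s b - t) * (fst q - fst s) < 0" "(slope s b - t) * (fst b - fst q) > 0"
    using ts gt fb by (simp_all add: algebra_simps)
  then show False using bounds by (smt (verit) mult_nonneg_nonneg mult_nonpos_nonneg)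
qed

text \<open>The chord \<open>s b\<close> separates \<open>x\<close> from the cup. A supporting line
  at a cup point also has \<open>x\<close> strictly above it, because \<open>x\<close> lies above
  the chord, whose endpoints are on or above that line.\<close>

lemma cup_insert_above_convex_gon:
  assumes cup: "is_cup k ps" and sub: "set ps \<subseteq> P" and "ps \<noteq> []" and "x \<in> P"
  defines "s \<equiv> hd ps" and "b \<equiv> last ps"
  assumes x: "fst s < fst x" "fst x < fst b" "slope s b < slope s x"
  shows "has_convex_gon (Suc k) P"
proof -
  have mem: "s \<in> set ps" "b \<in> set ps" using \<open>ps \<noteq> []\<close> by (auto simp: s_def b_def)
  have fx: "snd s - slope s b * fst s < snd x - slope s b * fst x"
  proof -
    have "slope s b * (fst x - fst s) < snd x - snd s"
      using x slope_times_diff[of s x] mult_strict_right_mono[of "slope s b" "slope s x" "fst x - fst s"]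
      by simp
    then show ?thesis by (simp add: algebra_simps)
  qed
  have below: "snd q - slope s b * fst q \<le> snd s - slope s b * fst s" if "q \<in> set ps" for q
    using cup_below_chord[OF cup that] x by (simp add: s_def b_def)
  have x_notin: "x \<notin> set ps" using below[of x] fx by auto
  have sb: "slope s b * (fst b - fst s) = snd b - snd s"
    using x by (intro slope_times_diff) auto
  have "p \<notin> convex hull (insert x (set ps) - {p})" if p: "p \<in> insert x (set ps)" for p
  proof (cases "p = x")
    case True
    have "convex hull (set ps) \<subseteq> {z. snd z - slope s b * fst z \<le> snd s - slope s b * fst s}"
      using below by (intro hull_minimal convex_half_plane_le) auto
    with fx have "x \<notin> convex hull (set ps)" by auto
    then show ?thesis using True x_notin by simp
  next
    case False
    then have p: "p \<in> set ps" using p by auto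
    obtain t where t: "\<And>q. q \<in> set ps \<Longrightarrow> q \<noteq> p \<Longrightarrow> snd p - t * fst p < snd q - t * fst q"
      using cup_supporting_slope[OF cup p] by blast
    have t': "snd p - t * fst p \<le> snd s - t * fst s" "snd p - t * fst p \<le> snd b - t * fst b"
      using t[OF mem(1)] t[OF mem(2)] by fastforce+
    have "snd p - t * fst p < snd x - t * fst x"
    \<comment> \<open>Measured against slope \<open>t\<close>, the lower end of the chord is
      \<open>s\<close> in the first case and \<open>b\<close> in the second; \<open>x\<close> is
      compared with that end.\<close>
    proof (cases "t \<le> slope s b")
      case True
      then have "0 \<le> (slope s b - t) * (fst x - fst s)" using x by simp
      then show ?thesis using fx t' by (simp add: algebra_simps)
    next
      case False
      then have "0 \<le> (t - slope s b) * (fst b - fst x)" using x by simp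
      then show ?thesis using fx t' sb by (simp add: algebra_simps)
    qed
    with t show ?thesis
      by (intro not_in_hull_if_strictly_below[of _ p t]) auto
  qed
  then have "convex_position (insert x (set ps))" unfolding convex_position_def by blast
  moreover have "card (insert x (set ps)) = Suc k" using x_notin cup_distinct[OF cup] by simp
  ultimately show ?thesis
    unfolding has_convex_gon_def using sub \<open>x \<in> P\<close>
    by (intro exI[of _ "insert x (set ps)"]) auto
qed

section \<open>The cup-cap theorem\<close>

lemma no_pair_card_le_1:
  assumes adm: "admissible S" and no: "\<And>p q. p \<in> S \<Longrightarrow> q \<in> S \<Longrightarrow> fst p < fst q \<Longrightarrow> False"
  shows "card S \<le> 1"
proof -
  have "p = q" if "p \<in> S" "q \<in> S" for p q
    using adm no that unfolding admissible_def inj_on_def by (metis linorder_neqE)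
  then show ?thesis by (metis One_nat_def card_le_Suc0_iff_eq adm admissible_def)
qed

text \<open>This is the Erdos-Szekeres bound, by Pascal's rule. \<open>T\<close> collects the right
  endpoints of cups with \<open>a + 1\<close> points. Removing \<open>T\<close> destroys these cups,
  and \<open>T\<close> has no cap with \<open>b + 1\<close> points, since a cup ending where such a
  cap starts would extend one of the two.\<close>

theorem cup_cap_free_card_le:
  assumes "admissible S" "cup_cap_free (a + 2) (b + 2) S"
  shows "card S \<le> (a + b) choose a"
  using assms
proof (induction "a + b" arbitrary: a b S rule: less_induct)
  case less
  show ?case
  proof (cases "a = 0 \<or> b = 0")
    \<comment> \<open>Two points form both a 2-cup and a 2-cap, so at most one point is
      possible.\<close>
    case True
    have "False" if "p \<in> S" "q \<in> S" "fst p < fst q" for p q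
    proof -
      have "is_cup 2 [p, q]" "is_cap 2 [p, q]" using that by (auto simp: is_cup_def is_cap_def)
      moreover have "set [p, q] \<subseteq> S" using that by simp
      ultimately show False
        using True less.prems(2) unfolding cup_cap_free_def by (metis add_0)
    qed
    then have "card S \<le> 1" using no_pair_card_le_1 less.prems(1) by blast
    then show ?thesis using True by auto
  next
    case False
    then obtain a' b' where ab: "a = Suc a'" "b = Suc b'" by (metis not0_implies_Suc)
    define T where "T = {v \<in> S. \<exists>ps. set ps \<subseteq> S \<and> is_cup (a' + 2) ps \<and> last ps = v}"
    have fin: "finite S" using less.prems(1) by (simp add: admissible_def)
    have "cup_cap_free (a' + 2) (b + 2) (S - T)"
      unfolding cup_cap_free_def
    proof (intro conjI notI)
      assume "\<exists>ps. set ps \<subseteq> S - T \<and> is_cup (a' + 2) ps"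
      then obtain ps where ps: "set ps \<subseteq> S - T" "is_cup (a' + 2) ps" by blast
      then have "ps \<noteq> []" by (auto simp: is_cup_def)
      then have "last ps \<in> S - T" using ps by (meson last_in_set subsetD)
      then show False using ps unfolding T_def by blast
    next
      assume "\<exists>ps. set ps \<subseteq> S - T \<and> is_cap (b + 2) ps"
      then show False using less.prems(2) unfolding cup_cap_free_def by blast
    qed
    then have 1: "card (S - T) \<le> (a' + b) choose a'"
      using less.hyps[of a' b "S - T"] ab admissible_subset[OF less.prems(1)] by simp
    have "cup_cap_free (a + 2) (b' + 2) T"
      unfolding cup_cap_free_def
    proof (intro conjI notI)
      assume "\<exists>ps. set ps \<subseteq> T \<and> is_cup (a + 2) ps"
      then show False using less.prems(2) unfolding cup_cap_free_def T_def by blast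
    next
      assume "\<exists>ps. set ps \<subseteq> T \<and> is_cap (b' + 2) ps"
      then obtain qs where qs: "set qs \<subseteq> T" "is_cap (b' + 2) qs" by blast
      then obtain v w ws where qs_eq: "qs = v # w # ws"
        by (cases qs; cases "tl qs") (auto simp: is_cap_def)
      from qs qs_eq have "v \<in> T" by auto
      then obtain ps where ps: "set ps \<subseteq> S" "is_cup (a' + 2) ps" "last ps = v"
        unfolding T_def by blast
      then obtain xs u where ps_eq: "ps = xs @ [u, v]"
        by (cases ps rule: rev_cases; cases "butlast ps" rule: rev_cases) (auto simp: is_cup_def)
      have uv: "fst u < fst v" using ps(2) ps_eq by (auto simp: is_cup_def sorted_wrt_append)
      have vw: "fst v < fst w" using qs(2) qs_eq by (auto simp: is_cap_def)
      have mem: "u \<in> S" "v \<in> S" "w \<in> S" "set ws \<subseteq> S"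
        using ps(1) ps_eq qs(1) qs_eq unfolding T_def by auto
      have "slope u v \<noteq> slope v w"
        using less.prems(1) mem uv vw by (intro admissible_slope_neq[of S]) auto
      then consider "slope u v < slope v w" | "slope v w < slope u v" by linarith
      then show False
      proof cases
        case 1
        then have "is_cup (a + 2) (xs @ [u, v, w])"
          using is_cup_snoc[of "a' + 2" xs u v w] ps(2) ps_eq vw ab by simp
        moreover have "set (xs @ [u, v, w]) \<subseteq> S" using mem ps(1) ps_eq by auto
        ultimately show False using less.prems(2) unfolding cup_cap_free_def by blast
      next
        case 2
        then have "is_cap (b + 2) (u # v # w # ws)"
          using is_cap_Cons[of "b' + 2" v w ws u] qs(2) qs_eq uv ab by simp
        moreover have "set (u # v # w # ws) \<subseteq> S" using mem by auto
        ultimately show False using less.prems(2) unfolding cup_cap_free_def by blast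
      qed
    qed
    moreover have "admissible T"
      using admissible_subset[OF less.prems(1)] by (auto simp: T_def)
    ultimately have 2: "card T \<le> (a + b') choose a"
      using less.hyps[of a b' T] ab by simp
    have "card S = card (S - T) + card T"
      using fin card_Diff_subset[of T S] card_mono[of S T] finite_subset[of T S]
      by (auto simp: T_def)
    then show ?thesis using 1 2 ab by simp
  qed
qed

section \<open>Convexifying points\<close>

text \<open>As \<open>4 \<le> l\<close>, the last two points of the cap come after \<open>p\<close>
  and \<open>q\<close>, which may therefore lie outside \<open>S\<close>.\<close>

lemma is_cap_two_rightmost:
  assumes "is_cap l (p # q # cs)" "4 \<le> l" "set cs \<subseteq> S"
  shows "set (drop (l - 2) (p # q # cs)) \<subseteq> S"
proof -
  have "drop (l - 2) (p # q # cs) = drop (l - 4) cs"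
    using assms by (auto simp: drop_Cons' numeral_eq_Suc)
  then show ?thesis using assms(3) set_drop_subset[of "l - 4" cs] by auto
qed

text \<open>All 4-cups found below start with \<open>a, s\<close> and all \<open>l\<close>-caps end
  with \<open>c, d, ds\<close>, which places the required points in \<open>S\<close>.\<close>

lemma cap_left_end_convexifying:
  assumes l: "4 \<le> l" and free: "cup_cap_free 4 l S"
    and a: "a \<in> S" "fst a < fst (hd cs)"
    and cap: "is_cap (l - 1) cs" "set cs \<subseteq> S"
    and adm: "admissible S"
  shows "convexifying_point 4 l S (hd cs)"
proof -
  obtain s c d ds where cs: "cs = s # c # d # ds"
    using cap(1) l by (cases cs; cases "tl cs"; cases "tl (tl cs)") (auto simp: is_cap_def)
  have S: "s \<in> S" "c \<in> S" "d \<in> S" "set ds \<subseteq> S" using cap(2) cs by auto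
  have lSuc: "l - 1 = Suc (l - 2)" "l = Suc (Suc (l - 2))" using l by auto
  have capc: "is_cap (l - 2) (c # d # ds)"
    using cap(1) cs lSuc(1) is_cap_tl by metis
  have as: "fst a < fst s" and sc: "fst s < fst c"
    and scd: "slope c d < slope s c"
    using a cs cap(1) by (auto simp: is_cap_def)
  have asc: "slope a s < slope s c"
  proof (rule ccontr)
    assume "\<not> ?thesis"
    moreover have "slope a s \<noteq> slope s c"
      using adm a S as sc by (intro admissible_slope_neq[of S]) auto
    ultimately have "is_cap l (a # cs)"
      using is_cap_Cons[of "l - 1" s c "d # ds" a] cap(1) as l by (simp add: cs)
    moreover have "set (a # cs) \<subseteq> S" using a cap by simp
    ultimately show False using free unfolding cup_cap_free_def by blast
  qed
  have cup_or_cap_or_gon: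
    "(\<exists>ps. set ps \<subseteq> P \<and> is_cup 4 ps \<and> set (take 2 ps) \<subseteq> S) \<or>
     (\<exists>ps. set ps \<subseteq> P \<and> is_cap l ps \<and> set (drop (l - 2) ps) \<subseteq> S) \<or> has_convex_gon n P"
    if n: "4 \<le> n" and B: "B \<inter> S = {}" and P: "P = B \<union> S" "admissible P"
      and ps: "set ps \<subseteq> P" "is_cup (n - 1) ps" "hd ps = s" "last ps \<in> B" for n B P ps
  proof -
    obtain us q r b where ps_eq: "ps = us @ [q, r, b]"
    proof -
      have len: "3 \<le> length ps" using ps(2) n by (simp add: is_cup_def)
      obtain xs b where 1: "ps = xs @ [b]" using len by (cases ps rule: rev_cases) auto
      obtain ys r where 2: "xs = ys @ [r]" using len 1 by (cases xs rule: rev_cases) auto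
      obtain us q where "ys = us @ [q]" using len 1 2 by (cases ys rule: rev_cases) auto
      with 1 2 that show ?thesis by simp
    qed
    have bB: "b \<in> B" and mem: "q \<in> P" "r \<in> P" "b \<in> P" "set us \<subseteq> P" using ps ps_eq by auto
    have SP: "S \<subseteq> P" using P by auto
    have bc: "b \<noteq> c" "fst b \<noteq> fst c"
      using bB B S P mem unfolding admissible_def inj_on_def by blast+
    note qrb = is_cup_last_slope[OF ps(2)[unfolded ps_eq]]
    have s_cases: "us = [] \<and> q = s \<or> s \<in> set us" using ps(3) ps_eq by (cases us) auto
    have sq: "fst s \<le> fst q"
      using cup_fst_bounds(1)[OF ps(2)] ps(3) ps_eq by simp
    have sr: "fst s < fst r" and sb: "fst s < fst b" using sq qrb by auto
    \<comment> \<open>If \<open>s\<close> is not adjacent to \<open>r\<close>, a supporting slope at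
      \<open>r\<close> separates the two slopes.\<close>
    have sr_rb: "slope s r < slope r b"
    proof (cases "q = s")
      case True
      then show ?thesis using qrb by simp
    next
      case False
      then have "s \<in> set us" using s_cases by auto
      have "\<exists>t. \<forall>z\<in>set ps. z \<noteq> r \<longrightarrow> snd r - t * fst r < snd z - t * fst z"
        using cup_supporting_slope[OF ps(2), of r] ps_eq
        by (metis in_set_conv_decomp append_Cons append_assoc append_Nil)
      then obtain t where "snd r - t * fst r < snd s - t * fst s" "snd r - t * fst r < snd b - t * fst b"
        using \<open>s \<in> set us\<close> ps_eq sr qrb by auto
      then have "slope s r * (fst r - fst s) < t * (fst r - fst s)"
        "t * (fst b - fst r) < slope r b * (fst b - fst r)"
        using slope_times_diff[of s r] slope_times_diff[of r b] sr qrb by (simp_all add: algebra_simps)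
      then have "slope s r < t" "t < slope r b" using sr qrb by simp_all
      then show ?thesis by simp
    qed
    \<comment> \<open>Applied with \<open>r, b\<close> and with \<open>q, r\<close> as the two
      points put in front of the cap \<open>c, d, ds\<close> of \<open>l - 2\<close> points.\<close>
    have cap_or_other: ?thesis
      if "x \<in> P" "y \<in> P" "fst x < fst y" "fst y < fst c" "slope y c < slope x y" "slope c d < slope y c"
      for x y
    proof -
      have cap: "is_cap l (x # y # c # d # ds)"
        using is_cap_Cons[OF is_cap_Cons[OF capc]] that lSuc by metis
      then have "set (drop (l - 2) (x # y # c # d # ds)) \<subseteq> S"
        using l S by (intro is_cap_two_rightmost) auto
      moreover have "set (x # y # c # d # ds) \<subseteq> P" using that S SP by auto
      ultimately show ?thesis using cap by blast
    qed
    have cup_from_as: ?thesis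
      if "x \<in> P" "y \<in> P" "fst s < fst x" "fst x < fst y" "slope a s < slope s x" "slope s x < slope x y"
      for x y
    proof -
      have "is_cup 4 [a, s, x, y]" using that as by (auto simp: is_cup_def)
      moreover have "set [a, s, x, y] \<subseteq> P" "set (take 2 [a, s, x, y]) \<subseteq> S"
        using that a S SP by auto
      ultimately show ?thesis by blast
    qed
    have n1: "Suc (n - 1) = n" using n by simp
    have "slope b s \<noteq> slope s c"
      using P(2) mem S SP bc sb sc by (intro admissible_slope_neq[of P]) auto
    then consider "slope s b < slope s c" | "slope s c < slope s b"
      by (metis linorder_neqE slope_commute)
    then show ?thesis
    proof cases
      case 1
      show ?thesis
      proof (cases "fst c < fst b")
        case True
        have "has_convex_gon (Suc (n - 1)) P"
          using cup_insert_above_convex_gon[OF ps(2,1) _, of c] S SP ps(3) ps_eq sc True 1 by auto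
        then show ?thesis using n1 by simp
      next
        case False
        then have "fst b < fst c" using bc by simp
        have "slope r b \<noteq> slope b c"
          using P(2) mem S SP bc qrb \<open>fst b < fst c\<close> by (intro admissible_slope_neq[of P]) auto
        then consider "slope r b < slope b c" | "slope b c < slope r b" by linarith
        then show ?thesis
        proof cases
          case 1
          \<comment> \<open>Here \<open>c\<close> lies to the right of \<open>b\<close> and prolongs
            the cup to \<open>n\<close> points.\<close>
          then have "is_cup (Suc (n - 1)) ((us @ [q]) @ [r, b, c])"
            using \<open>fst b < fst c\<close> ps(2) ps_eq by (intro is_cup_snoc) auto
          moreover have "set ((us @ [q]) @ [r, b, c]) \<subseteq> P" using mem S SP by auto
          ultimately show ?thesis using cup_has_convex_gon n1 by metis
        next
          case 2
          \<comment> \<open>Since \<open>b\<close> is below the segment \<open>s c\<close>,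
            \<open>slope b c\<close> exceeds \<open>slope s c\<close>, hence also
            \<open>slope c d\<close>: the cap turns correctly at \<open>c\<close>.\<close>
          have "slope s b < slope b c"
            using slope_less_iff_left[OF sb \<open>fst b < fst c\<close>] \<open>slope s b < slope s c\<close> by simp
          then have "slope s c < slope b c"
            using slope_less_iff_right[OF sb \<open>fst b < fst c\<close>] by simp
          then show ?thesis
            using cap_or_other[of r b] mem qrb \<open>fst b < fst c\<close> 2 scd by simp
        qed
      qed
    next
      case 2
      show ?thesis
      proof (cases "fst c < fst b")
        case True
        then have "slope s c < slope c b" using slope_less_iff_left[OF sc True] 2 by simp
        then show ?thesis using cup_from_as[of c b] mem S SP sc True asc by auto
      next
        case False
        then have bc': "fst b < fst c" using bc by simp
        have rc: "fst r < fst c" using qrb bc' by simp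
        have "slope a s \<noteq> slope s r"
          using P(2) a mem S SP as sr by (intro admissible_slope_neq[of P]) auto
        then consider "slope a s < slope s r" | "slope s r < slope a s" by linarith
        then show ?thesis
        proof cases
          case 1
          then show ?thesis using cup_from_as[of r b] mem sr qrb sr_rb by auto
        next
          case below: 2
          \<comment> \<open>Now \<open>r\<close> is below the line \<open>s c\<close>, so again
            \<open>slope r c\<close> exceeds \<open>slope s c\<close> and thus
            \<open>slope c d\<close>.\<close>
          have "slope s r < slope s c" using below asc by simp
          then have "slope s r < slope r c" using slope_less_iff_left[OF sr rc] by simp
          then have scrc: "slope s c < slope r c" using slope_less_iff_right[OF sr rc] by simp
          have "slope q r \<noteq> slope r c"
            using P(2) mem S SP qrb rc by (intro admissible_slope_neq[of P]) auto
          then consider "slope r c < slope q r" | "slope q r < slope r c" by linarith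
          then show ?thesis
          proof cases
            case 1
            then show ?thesis using cap_or_other[of q r] mem qrb rc scrc scd by simp
          next
            case 2
            \<comment> \<open>\<open>c\<close> replaces \<open>b\<close> as right end, keeping
              \<open>n - 1\<close> points; \<open>b\<close> then lies above the new chord
              \<open>s c\<close> and is inserted as the \<open>n\<close>-th point.\<close>
            have "is_cup (n - 2) (us @ [q, r])"
              using is_cup_butlast[of "n - 2" "us @ [q]" r b] ps(2) ps_eq n
              by (simp add: numeral_eq_Suc Suc_diff_Suc)
            then have cup: "is_cup (Suc (n - 2)) (us @ [q, r, c])"
              using is_cup_snoc rc 2 by blast
            have hd: "hd (us @ [q, r, c]) = s" using ps(3) ps_eq by (cases us) auto
            have "has_convex_gon (Suc (Suc (n - 2))) P"
              using cup_insert_above_convex_gon[OF cup, of P b] hd mem S SP sb bc'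
                \<open>slope s c < slope s b\<close> by auto
            moreover have "Suc (Suc (n - 2)) = n" using n by simp
            ultimately show ?thesis by simp
          qed
        qed
      qed
    qed
  qed
  show ?thesis
    unfolding convexifying_point_def
  proof (intro conjI allI impI)
    show "hd cs \<in> S" using S cs by simp
    show "\<exists>ps. set ps \<subseteq> S \<and> is_cap (l - 1) ps \<and> hd ps = hd cs" using cap by blast
  next
    fix n :: nat and B
    assume n: "4 \<le> n" and B: "B \<inter> S = {} \<and> admissible (B \<union> S) \<and>
      (\<exists>ps. set ps \<subseteq> B \<union> S \<and> is_cup (n - 1) ps \<and> hd ps = hd cs \<and> last ps \<in> B)"
    then obtain ps where "set ps \<subseteq> B \<union> S" "is_cup (n - 1) ps" "hd ps = s" "last ps \<in> B"
      using cs by auto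
    with cup_or_cap_or_gon[OF n _ refl] B
    show "(\<exists>ps. set ps \<subseteq> B \<union> S \<and> is_cup 4 ps \<and> set (take 2 ps) \<subseteq> S) \<or>
      (\<exists>ps. set ps \<subseteq> B \<union> S \<and> is_cap l ps \<and> set (drop (l - 2) ps) \<subseteq> S) \<or>
      has_convex_gon n (B \<union> S)"
      by blast
  qed
qed

lemma card_le_if_no_convexifying_point:
  assumes l: "4 \<le> l" and adm: "admissible S" and free: "cup_cap_free 4 l S"
    and none: "\<nexists>s. convexifying_point 4 l S s"
  shows "card S \<le> ((l - 1) choose 2) + 1"
proof (cases "S = {}")
  case False
  have fin: "finite S" using adm by (simp add: admissible_def)
  obtain a where a: "a \<in> S" "\<And>z. z \<in> S \<Longrightarrow> fst a \<le> fst z"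
    using ex_min_if_finite[of "fst ` S"] fin False by (metis arg_min_if_finite(1) arg_min_least)
  \<comment> \<open>An \<open>(l - 1)\<close>-cap avoiding the leftmost point \<open>a\<close> would
    start to the right of \<open>a\<close>, so its left end would be convexifying.\<close>
  have "cup_cap_free (2 + 2) ((l - 3) + 2) (S - {a})"
    unfolding cup_cap_free_def
  proof (intro conjI notI)
    assume "\<exists>ps. set ps \<subseteq> S - {a} \<and> is_cup (2 + 2) ps"
    then show False using free unfolding cup_cap_free_def by auto
  next
    assume "\<exists>ps. set ps \<subseteq> S - {a} \<and> is_cap (l - 3 + 2) ps"
    moreover have "l - 3 + 2 = l - 1" using l by simp
    ultimately obtain cs where cs: "set cs \<subseteq> S - {a}" "is_cap (l - 1) cs" by auto
    then have "cs \<noteq> []" using l by (auto simp: is_cap_def)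
    then have "hd cs \<in> S" "hd cs \<noteq> a" using cs hd_in_set[of cs] by blast+
    then have "fst a < fst (hd cs)"
      using a adm unfolding admissible_def inj_on_def by (metis order_le_less)
    then have "convexifying_point 4 l S (hd cs)"
      using cap_left_end_convexifying[OF l free a(1) _ cs(2) _ adm] cs(1) by blast
    then show False using none by blast
  qed
  then have "card (S - {a}) \<le> (2 + (l - 3)) choose 2"
    using admissible_subset[OF adm] by (intro cup_cap_free_card_le) auto
  moreover have "2 + (l - 3) = l - 1" using l by simp
  ultimately show ?thesis using a fin by (simp add: card_Diff_singleton)
qed simp

theorem theorem14:
  fixes l :: nat
  assumes "l \<ge> 4"
  shows "convexification 4 l \<le> ((l - 1) choose 2) + 1"
proof -
  let ?Q = "\<lambda>k. \<exists>S. admissible S \<and> card S = k \<and>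
     cup_cap_free 4 l S \<and> (\<nexists>s. convexifying_point 4 l S s)"
  have bound: "k \<le> ((l - 1) choose 2) + 1" if "?Q k" for k
    using that card_le_if_no_convexifying_point[OF assms] by blast
  \<comment> \<open>\<open>GREATEST\<close> attains its value only for a bounded, satisfiable
    predicate; the empty set is the witness.\<close>
  have "?Q 0"
    using assms by (intro exI[of _ "{}"])
      (auto simp: admissible_def cup_cap_free_def is_cup_def is_cap_def convexifying_point_def)
  then have "?Q (GREATEST k. ?Q k)"
    using bound by (rule GreatestI_nat)
  then show ?thesis unfolding convexification_def by (rule bound)
qed

end
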